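(* Let $a,b\geq 1$ be integers with $\gcd(a,b)=1$. If $(a,b)$ is not one of $(29,1)$, $(45,1)$, $(47,1)$, $(50,1)$, $(55,1)$, $(67,1)$, $(73,1)$, $(79,1)$, then $$\operatorname{Ap}(S(a,b),a)=\{\mu(n)a+nb : n=0,1,2,\dots,a-1\}.$$
   Context: $\mathbb{N}_0=\{0,1,2,\ldots\}$ and $\binom{n}{2}=\frac{n(n-1)}{2}$. For $a,b\in\mathbb{N}_0$, $S(a,b)$ is the submonoid of $(\mathbb{N}_0,+)$ generated by $\left\{na+\binom{n}{2}b : n\in\mathbb{N}_0\right\}$; it is a numerical semigroup (a submonoid of $\mathbb{N}_0$ with finite complement) exactly when $\gcd(a,b)=1$. For a numerical semigroup $S$ and nonzero $n\in S$, the Apéry set is $\operatorname{Ap}(S,n)=\{s\in S : s-n\notin S\}$. Let $T\subseteq\mathbb{N}_0^2$ be the additive monoid consisting of all finite linear combinations with coefficients in $\mathbb{N}_0$ of the vectors $\left(i,\binom{i}{2}\right)$, $i\in\mathbb{N}_0$. For $n\in\mathbb{N}_0$, $\mu(n):=\min\{m\in\mathbb{N}_0 : (m,n)\in T\}$. *)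

theory Defs
  imports Complex_Main
begin

definition add_submonoid :: "nat set \<Rightarrow> bool" where
  "add_submonoid M \<longleftrightarrow> 0 \<in> M \<and> (\<forall>x\<in>M. \<forall>y\<in>M. x + y \<in> M)"

definition S :: "nat \<Rightarrow> nat \<Rightarrow> nat set" where
  "S a b = add_submonoid hull {n * a + (n choose 2) * b | n. True}"

(* The difference s - n is taken in the integers, so that every s \<in> M with s < n
   belongs to the Apery set. *)
definition Ap :: "nat set \<Rightarrow> nat \<Rightarrow> nat set" where
  "Ap M n = {s \<in> M. int s - int n \<notin> int ` M}"

definition T :: "(nat \<times> nat) set" where
  "T = {(\<Sum>i\<in>I. c i * i, \<Sum>i\<in>I. c i * (i choose 2)) | (I :: nat set) (c :: nat \<Rightarrow> nat). finite I}"

(* The minimum exists for every n, since n (2, 1) = (2 n, n) \<in> T. *)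
definition \<mu> :: "nat \<Rightarrow> nat" where
  "\<mu> n = (LEAST m. (m, n) \<in> T)"

end

theory Submission
  imports Defs "HOL-Library.Code_Binary_Nat" "HOL-Number_Theory.Cong"
begin

text \<open>
  Since \<open>(1, 0) \<in> T\<close>, the semigroup consists of the numbers \<open>m a + n b\<close> with \<open>m \<ge> \<mu> n\<close>.  Comparing the
  elements of one residue class modulo \<open>a\<close> reduces the claim to \<open>\<mu> n \<le> \<mu> (n + k a) + k b\<close> for
  \<open>n < a\<close> and \<open>k \<ge> 1\<close>.  As \<open>n + k a > 2 n\<close>, this follows from the trivial lower bound
  \<open>N \<le> (\<mu> N choose 2)\<close> as soon as \<open>(\<mu> n - 2 choose 2) \<le> 2 n\<close>.  The latter holds for \<open>n \<ge> 406\<close> by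
  removing the largest possible vector from \<open>n\<close> and bounding the rest linearly; for \<open>n < 406\<close> it is
  read off a table of \<open>\<mu>\<close> and fails only for eight values of \<open>n\<close>.  Those are checked against the
  table directly, which is where the exceptional pairs appear.
\<close>

section \<open>The monoid T and the function \<mu>\<close>

text \<open>Adding one generator at a time turns statements about T into inductions on the number of
  summands.\<close>

inductive_set gen_T :: "(nat \<times> nat) set" where
  zero: "(0, 0) \<in> gen_T"
| step: "(m, n) \<in> gen_T \<Longrightarrow> (m + i, n + (i choose 2)) \<in> gen_T"

lemma gen_T_step_mult:
  "(m, n) \<in> gen_T \<Longrightarrow> (m + c * i, n + c * (i choose 2)) \<in> gen_T"
proof (induction c)
  case (Suc c)
  then show ?case
    using gen_T.step[of "m + c * i" "n + c * (i choose 2)" i] by (simp add: algebra_simps)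
qed simp

lemma T_eq_gen_T: "T = gen_T"
proof (intro equalityI subrelI)
  fix m n assume "(m, n) \<in> T"
  then obtain I :: "nat set" and c where I: "finite I"
    and mn: "m = (\<Sum>i\<in>I. c i * i)" "n = (\<Sum>i\<in>I. c i * (i choose 2))"
    unfolding T_def by blast
  from I have "((\<Sum>i\<in>I. c i * i), (\<Sum>i\<in>I. c i * (i choose 2))) \<in> gen_T"
  proof (induction I)
    case (insert x F)
    then show ?case using gen_T_step_mult[OF insert.IH, of "c x" x] by (simp add: add.commute)
  qed (simp add: gen_T.zero)
  then show "(m, n) \<in> gen_T" using mn by simp
next
  fix m n assume "(m, n) \<in> gen_T"
  then show "(m, n) \<in> T"
  proof induction
    case zero
    show ?case unfolding T_def by (auto intro!: exI[of _ "{}"])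
  next
    case (step m n i)
    then obtain I c where I: "finite I"
      and mn: "m = (\<Sum>i\<in>I. c i * i)" "n = (\<Sum>i\<in>I. c i * (i choose 2))"
      unfolding T_def by blast
    \<comment> \<open>The coefficients \<open>c\<close> are arbitrary outside \<open>I\<close>, so
      they are reset to 0 there before the possibly new index \<open>i\<close> gains one
      copy.\<close>
    define d where "d j = (if j \<in> I then c j else 0) + (if j = i then 1 else 0)" for j
    have *: "(\<Sum>j\<in>insert i I. d j * g j) = (\<Sum>j\<in>I. c j * g j) + g i" for g :: "nat \<Rightarrow> nat"
    proof -
      have "(\<Sum>j\<in>insert i I. d j * g j) =
          (\<Sum>j\<in>insert i I. if j \<in> I then c j * g j else 0) + (\<Sum>j\<in>insert i I. if j = i then g j else 0)"
        unfolding sum.distrib[symmetric] by (rule sum.cong) (auto simp: d_def algebra_simps)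
      also have "(\<Sum>j\<in>insert i I. if j \<in> I then c j * g j else 0) = (\<Sum>j\<in>I. c j * g j)"
        using I by (intro sum.mono_neutral_cong_right) auto
      also have "(\<Sum>j\<in>insert i I. if j = i then g j else 0) = g i"
        using I by simp
      finally show ?thesis .
    qed
    show ?case unfolding T_def mn using I *[of "\<lambda>i. i"] *[of "\<lambda>i. i choose 2"]
      by (auto intro!: exI[of _ "insert i I"] exI[of _ d])
  qed
qed

lemma T_add: "(m, n) \<in> T \<Longrightarrow> (m', n') \<in> T \<Longrightarrow> (m + m', n + n') \<in> T"
  unfolding T_eq_gen_T
proof (induction rule: gen_T.induct)
  case (step m n i)
  then show ?case using gen_T.step[of "m + m'" "n + n'" i] by (simp add: algebra_simps)
qed simp

lemma generator_in_T: "(i, i choose 2) \<in> T"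
  unfolding T_eq_gen_T using gen_T.step[OF gen_T.zero, of i] by simp

lemma T_mono: "(m, n) \<in> T \<Longrightarrow> m \<le> m' \<Longrightarrow> (m', n) \<in> T"
  unfolding T_eq_gen_T using gen_T_step_mult[of m n "m' - m" 1] by (simp add: binomial_eq_0)

lemma le_choose_two_add_one: "n \<le> (n choose 2) + 1"
  by (induction n) (auto simp: numeral_2_eq_2)

lemma choose_two_twice: "2 * (n choose 2) = n * (n - 1)"
  by (induction n) (auto simp: numeral_2_eq_2 algebra_simps)

lemma choose_two_add_le: "(m choose 2) + (i choose 2) \<le> (m + i) choose 2"
proof -
  have "(m + i) choose 2 = (m choose 2) + m * i + (i choose 2)"
    by (induction i) (simp_all add: numeral_2_eq_2 algebra_simps)
  then show ?thesis by simp
qed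

text \<open>By superadditivity of the binomial coefficient, merging all parts into one of size m can
  only increase the second coordinate.\<close>

lemma T_le_choose_two: "(m, n) \<in> T \<Longrightarrow> n \<le> m choose 2"
  unfolding T_eq_gen_T
proof (induction rule: gen_T.induct)
  case (step m n i)
  then show ?case using choose_two_add_le[of m i] by linarith
qed simp

text \<open>Parts of size 0 or 1 leave the second coordinate at 0, so a positive n forces a part of
  size at least 2.\<close>

lemma T_remove_part:
  assumes "(m, n) \<in> T" and "n > 0"
  obtains x m' n' where "x \<ge> 2" "m = m' + x" "n = n' + (x choose 2)" "(m', n') \<in> T"
proof -
  from assms(1)[unfolded T_eq_gen_T] assms(2)
  have "\<exists>x m' n'. x \<ge> 2 \<and> m = m' + x \<and> n = n' + (x choose 2) \<and> (m', n') \<in> gen_T"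
  proof induction
    case (step m n i)
    show ?case
    proof (cases "i \<ge> 2")
      case False
      then have "i choose 2 = 0" by (simp add: binomial_eq_0)
      with step obtain x m' n' where "x \<ge> 2" "m = m' + x" "n = n' + (x choose 2)" "(m', n') \<in> gen_T"
        by auto
      with gen_T.step[of m' n' i] \<open>i choose 2 = 0\<close> show ?thesis
        by (intro exI[of _ x] exI[of _ "m' + i"] exI[of _ n']) auto
    qed (use step in blast)
  qed simp
  with that show thesis unfolding T_eq_gen_T by blast
qed

lemma T_iff: "(m, n) \<in> T \<longleftrightarrow> \<mu> n \<le> m"
proof -
  have "(2 * n, n) \<in> T"
    unfolding T_eq_gen_T using gen_T_step_mult[OF gen_T.zero, of n 2] by (simp add: mult.commute)
  then have "(\<mu> n, n) \<in> T" unfolding \<mu>_def by (rule LeastI)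
  moreover have "\<mu> n \<le> m" if "(m, n) \<in> T"
    unfolding \<mu>_def using that by (rule Least_le)
  ultimately show ?thesis using T_mono by blast
qed

lemma mu_in_T: "(\<mu> n, n) \<in> T"
  by (simp add: T_iff)

lemma mu_zero: "\<mu> 0 = 0"
  using T_iff[of 0 0] generator_in_T[of 0] by (simp add: binomial_eq_0)

lemma mu_add_choose_two_le: "\<mu> (n + (x choose 2)) \<le> x + \<mu> n"
  using T_add[OF generator_in_T[of x] mu_in_T[of n]] by (simp add: T_iff add.commute)

lemma le_choose_two_mu: "n \<le> \<mu> n choose 2"
  by (rule T_le_choose_two[OF mu_in_T])

text \<open>Removing a part from an optimal representation leaves an optimal one. This makes \<mu>
  computable by recursion over the removed part.\<close>

lemma mu_attained:
  assumes "n > 0"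
  obtains x where "x \<ge> 2" "(x choose 2) \<le> n" "\<mu> n = x + \<mu> (n - (x choose 2))"
proof -
  from T_remove_part[OF mu_in_T assms] obtain x m' n'
    where x: "x \<ge> 2" "\<mu> n = m' + x" "n = n' + (x choose 2)" "(m', n') \<in> T" by metis
  then have "\<mu> n' \<le> m'" by (simp add: T_iff)
  with x mu_add_choose_two_le[of n' x] show thesis
    by (intro that[of x]) auto
qed

section \<open>A table of \<mu>\<close>

text \<open>The list \<open>ys\<close> holds \<open>\<mu> (N - 1), \<dots>, \<mu> 0\<close> with its first \<open>(x choose 2) - 1\<close> entries dropped;
  consecutive offsets differ by \<open>(x + 1 choose 2) - (x choose 2) = x\<close>.\<close>

function best :: "nat \<Rightarrow> nat list \<Rightarrow> nat \<Rightarrow> nat" where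
  "best x [] acc = acc"
| "best x (y # ys) acc = best (Suc x) (drop (x - 1) ys) (min acc (x + y))"
  by pat_completeness auto
termination by (relation "measure (\<lambda>(x, ys, acc). length ys)") auto

fun table :: "nat \<Rightarrow> nat list" where
  "table 0 = [0]"
| "table (Suc n) = (let ys = table n in best 2 ys (2 + hd ys) # ys)"

lemma best_eq_Min:
  assumes "x \<ge> 2"
  shows "best x (drop ((x choose 2) - 1) (map \<mu> (rev [0..<N]))) acc =
    Min (insert acc ((\<lambda>z. z + \<mu> (N - (z choose 2))) ` {z. x \<le> z \<and> (z choose 2) \<le> N}))"
  using assms
\<comment> \<open>The measure drops because x \<le> (x choose 2) + 1 \<le> N + 1 whenever the
  recursion continues.\<close>
proof (induction "N + 2 - x" arbitrary: x acc rule: less_induct)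
  case less
  let ?Z = "\<lambda>x. {z. x \<le> z \<and> (z choose 2) \<le> N}"
  let ?g = "\<lambda>z. z + \<mu> (N - (z choose 2))"
  have suc: "Suc x choose 2 = x + (x choose 2)" by (simp add: numeral_2_eq_2)
  have fin: "finite (?Z w)" for w
    by (rule finite_subset[of _ "{..N + 1}"]) (use le_choose_two_add_one in \<open>auto intro: order_trans\<close>)
  have pos: "x choose 2 > 0" using less.prems by simp
  show ?case
  proof (cases "(x choose 2) \<le> N")
    case False
    have "\<not> (z choose 2) \<le> N" if "x \<le> z" for z
      using False binomial_right_mono[OF that, of 2] by linarith
    then have "?Z x = {}" by auto
    then have m: "Min (insert acc (?g ` ?Z x)) = acc" by (metis Min_singleton image_empty)
    \<comment> \<open>The full list has length N, so it is exhausted exactly when x choose 2 exceeds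
      N.\<close>
    have "drop ((x choose 2) - 1) (map \<mu> (rev [0..<N])) = []" using False by simp
    then show ?thesis unfolding m by (simp only: best.simps)
  next
    case True
    let ?c = "(x choose 2) - 1"
    have "?c < N" and "N - Suc ?c = N - (x choose 2)" using True pos by linarith+
    then have "drop ?c (map \<mu> (rev [0..<N])) =
        \<mu> (N - (x choose 2)) # drop (Suc ?c) (map \<mu> (rev [0..<N]))"
      by (subst Cons_nth_drop_Suc[symmetric]) (simp_all add: rev_nth del: One_nat_def)
    moreover have "drop (x - 1) (drop (Suc ?c) (map \<mu> (rev [0..<N]))) =
        drop ((Suc x choose 2) - 1) (map \<mu> (rev [0..<N]))"
      using pos less.prems unfolding suc drop_drop by (intro arg_cong2[where f = drop]) auto
    ultimately have "best x (drop ?c (map \<mu> (rev [0..<N]))) acc =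
        best (Suc x) (drop ((Suc x choose 2) - 1) (map \<mu> (rev [0..<N]))) (min acc (?g x))"
      by (simp only: best.simps)
    also have "\<dots> = Min (insert (min acc (?g x)) (?g ` ?Z (Suc x)))"
      using less.prems le_choose_two_add_one[of x] True by (intro less.hyps) auto
    also have "\<dots> = Min (insert acc (insert (?g x) (?g ` ?Z (Suc x))))"
    proof -
      have "finite (?g ` ?Z (Suc x))" using fin by blast
      then show ?thesis by (cases "?g ` ?Z (Suc x) = {}") (simp_all add: min.assoc del: image_is_empty)
    qed
    also have "insert (?g x) (?g ` ?Z (Suc x)) = ?g ` ?Z x"
    proof -
      have "?Z x = insert x (?Z (Suc x))" using True by (auto simp: Suc_le_eq le_less)
      then show ?thesis by simp
    qed
    finally show ?thesis .
  qed
qed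

lemma mu_eq_best:
  assumes "N > 0"
  shows "\<mu> N = best 2 (map \<mu> (rev [0..<N])) (2 + \<mu> (N - 1))"
proof -
  let ?A = "(\<lambda>z. z + \<mu> (N - (z choose 2))) ` {z. 2 \<le> z \<and> (z choose 2) \<le> N}"
  have fin: "finite {z. 2 \<le> z \<and> (z choose 2) \<le> N}"
    by (rule finite_subset[of _ "{..N + 1}"]) (use le_choose_two_add_one in \<open>auto intro: order_trans\<close>)
  obtain x where "x \<ge> 2" "(x choose 2) \<le> N" "\<mu> N = x + \<mu> (N - (x choose 2))"
    using mu_attained[OF assms] by metis
  then have "\<mu> N \<in> ?A" by auto
  moreover have "\<mu> N \<le> y" if "y \<in> ?A" for y
  proof -
    from that obtain z where "(z choose 2) \<le> N" "y = z + \<mu> (N - (z choose 2))" by auto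
    with mu_add_choose_two_le[of "N - (z choose 2)" z] show ?thesis by simp
  qed
  \<comment> \<open>The initial accumulator is the candidate z = 2, so it does not change the
    minimum.\<close>
  moreover have "2 + \<mu> (N - 1) \<in> ?A" using assms by (auto intro!: image_eqI[of _ _ 2])
  ultimately have "Min (insert (2 + \<mu> (N - 1)) ?A) = \<mu> N"
    using fin by (intro Min_eqI) auto
  with best_eq_Min[of 2 N "2 + \<mu> (N - 1)"] show ?thesis by simp
qed

lemma table_eq: "table n = map \<mu> (rev [0..<Suc n])"
proof (induction n)
  case (Suc n)
  have "hd (map \<mu> (rev [0..<Suc n])) = \<mu> n" by simp
  then show ?case using Suc mu_eq_best[of "Suc n"] by (simp add: Let_def)
qed (simp add: mu_zero)

definition exceptional :: "nat list" where
  "exceptional = [26, 33, 41, 44, 50, 53, 63, 74]"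

text \<open>The products below are \<open>2 * (m - 3 choose 2)\<close> and \<open>2 * (m - 2 choose 2)\<close>.  For exceptional \<open>n\<close>,
  the bound \<open>(m - 2 choose 2) < 154\<close> leaves only \<open>N < 154\<close> to be compared with \<open>n\<close>.\<close>

definition table_ok :: "nat list \<Rightarrow> bool" where
  "table_ok ms \<longleftrightarrow>
    list_all (\<lambda>(n, m). (m - 3) * (m - 4) \<le> 4 * n \<and>
      ((m - 2) * (m - 3) \<le> 4 * n \<or> List.member exceptional n \<and> (m - 2) * (m - 3) < 2 * 154))
      (zip [0..<406] ms) \<and>
    list_all (\<lambda>(n, m). 4 * m \<le> n + 27) (zip [0..<36] ms) \<and>
    list_all (\<lambda>n. list_all (\<lambda>(N, m). ms ! n \<le> m + 1 \<or> N \<le> 2 * n \<or>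
        List.member [29, 45, 47, 50, 55, 67, 73, 79] (N - n))
      (zip [0..<154] ms)) exceptional"

lemma table_ok_table: "table_ok (rev (table 405))"
  by code_simp

lemma rev_table: "rev (table n) = map \<mu> [0..<Suc n]"
  unfolding table_eq rev_map rev_rev_ident ..

lemma list_all_zip_table:
  assumes "list_all P (zip [0..<k] (rev (table K)))" and "n < k" and "k \<le> Suc K"
  shows "P (n, \<mu> n)"
proof -
  let ?zs = "zip [0..<k] (map \<mu> [0..<Suc K])"
  have "n < length ?zs" using assms(2,3) by simp
  moreover have "?zs ! n = (n, \<mu> n)" using assms(2,3) by (simp del: upt_Suc)
  ultimately show ?thesis using assms(1) unfolding rev_table by (metis list_all_length)
qed

lemma nth_rev_table: "n \<le> K \<Longrightarrow> rev (table K) ! n = \<mu> n"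
  unfolding rev_table by (simp del: upt_Suc)

lemma mu_small:
  assumes "n < 406"
  shows "(\<mu> n - 3) * (\<mu> n - 4) \<le> 4 * n"
    and "(\<mu> n - 2) * (\<mu> n - 3) \<le> 4 * n \<or> n \<in> set exceptional \<and> (\<mu> n - 2) * (\<mu> n - 3) < 2 * 154"
    and "n < 36 \<Longrightarrow> 4 * \<mu> n \<le> n + 27"
    and "n \<in> set exceptional \<Longrightarrow> N < 154 \<Longrightarrow> N > 2 * n \<Longrightarrow> \<mu> n \<le> \<mu> N + 1 \<or>
      N - n \<in> {29, 45, 47, 50, 55, 67, 73, 79}"
proof -
  note ok = table_ok_table[unfolded table_ok_def]
  from list_all_zip_table[OF ok[THEN conjunct1] assms]
  show "(\<mu> n - 3) * (\<mu> n - 4) \<le> 4 * n"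
    "(\<mu> n - 2) * (\<mu> n - 3) \<le> 4 * n \<or> n \<in> set exceptional \<and> (\<mu> n - 2) * (\<mu> n - 3) < 2 * 154"
    by auto
  show "4 * \<mu> n \<le> n + 27" if "n < 36"
    using list_all_zip_table[OF ok[THEN conjunct2, THEN conjunct1] that] by simp
  show "\<mu> n \<le> \<mu> N + 1 \<or> N - n \<in> {29, 45, 47, 50, 55, 67, 73, 79}"
    if "n \<in> set exceptional" "N < 154" "N > 2 * n"
  proof -
    have "list_all (\<lambda>(N, m). rev (table 405) ! n \<le> m + 1 \<or> N \<le> 2 * n \<or>
        List.member [29, 45, 47, 50, 55, 67, 73, 79] (N - n)) (zip [0..<154] (rev (table 405)))"
      using ok[THEN conjunct2, THEN conjunct2] that(1) unfolding list_all_iff[of _ exceptional] by blast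
    from list_all_zip_table[OF this that(2)] that(3) nth_rev_table[of n 405] show ?thesis
      using assms by auto
  qed
qed

section \<open>Bounds for \<mu>\<close>

text \<open>A part 9 costs 9 and covers 36 = 4 * 9, so removing it preserves the bound exactly; the
  table supplies n < 36.\<close>

lemma mu_linear_bound: "4 * \<mu> n \<le> n + 27"
proof (induction n rule: less_induct)
  case (less n)
  show ?case
  proof (cases "n < 36")
    case True
    then show ?thesis by (intro mu_small(3)) auto
  next
    case False
    have "(9::nat) choose 2 = 36" by (simp add: choose_two)
    with False mu_add_choose_two_le[of "n - 36" 9] less.IH[of "n - 36"] show ?thesis by simp
  qed
qed

text \<open>With x the largest part that fits, the remainder is below x, and its linear bound gives
  4 \<mu>(n) \<le> 5x + 26.\<close>

lemma mu_large:
  assumes "n \<ge> 406"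
  shows "(\<mu> n - 2) * (\<mu> n - 3) \<le> 4 * n"
proof -
  define x where "x = (GREATEST x. (x choose 2) \<le> n)"
  have bd: "\<forall>z. (z choose 2) \<le> n \<longrightarrow> z \<le> n + 1" using le_choose_two_add_one by (meson add_le_mono1 order_trans)
  have 29: "(29::nat) choose 2 = 406" by (simp add: choose_two)
  have x: "(x choose 2) \<le> n" unfolding x_def
    by (rule GreatestI_nat[of "\<lambda>x. (x choose 2) \<le> n" 29, OF _ ]) (use 29 assms bd in auto)
  have x29: "x \<ge> 29" unfolding x_def
    by (rule Greatest_le_nat[of "\<lambda>x. (x choose 2) \<le> n"]) (use 29 assms bd in auto)
  have "\<not> (Suc x choose 2) \<le> n"
  proof
    assume "(Suc x choose 2) \<le> n"
    then have "Suc x \<le> x" unfolding x_def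
      by (rule Greatest_le_nat[of "\<lambda>x. (x choose 2) \<le> n"]) (use bd in auto)
    then show False by simp
  qed
  then have "n < x + (x choose 2)" by (simp add: numeral_2_eq_2)
  moreover have "\<mu> n \<le> x + \<mu> (n - (x choose 2))"
    using mu_add_choose_two_le[of "n - (x choose 2)" x] x by simp
  ultimately have "4 * \<mu> n \<le> 5 * x + 26"
    using mu_linear_bound[of "n - (x choose 2)"] x by linarith
  then have "(4 * (\<mu> n - 2)) * (4 * (\<mu> n - 3)) \<le> (5 * x + 18) * (5 * x + 14)"
    by (intro mult_mono) auto
  \<comment> \<open>This amounts to 7x^2 - 192x - 252 \<ge> 0, which holds at x = 29 but fails at x
    = 28; hence the threshold 406, which is 29 choose 2.\<close>
  also have "\<dots> \<le> 32 * (x * (x - 1))"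
  proof -
    obtain y where "x = 29 + y" using x29 le_Suc_ex by blast
    then show ?thesis by (simp add: algebra_simps)
  qed
  also have "\<dots> \<le> 64 * n" using x choose_two_twice[of x] by simp
  finally show ?thesis by simp
qed

lemma lt_mu_imp_le:
  assumes "\<mu> N + d < \<mu> n"
  shows "2 * N \<le> (\<mu> n - d - 1) * (\<mu> n - d - 2)"
proof -
  have "N \<le> (\<mu> n - d - 1) choose 2"
    using le_choose_two_mu[of N] binomial_right_mono[of "\<mu> N" "\<mu> n - d - 1" 2] assms by linarith
  with choose_two_twice[of "\<mu> n - d - 1"] show ?thesis by (simp add: numeral_2_eq_2)
qed

text \<open>The weaker slack 2 admits no exceptions: (\<mu>(n) - 3 choose 2) \<le> 2n holds for
  every n.\<close>

lemma mu_le_mu_add_two: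
  assumes "2 * n < N"
  shows "\<mu> n \<le> \<mu> N + 2"
proof (rule ccontr)
  assume "\<not> ?thesis"
  then have "2 * N \<le> (\<mu> n - 3) * (\<mu> n - 4)" using lt_mu_imp_le[of N 2 n] by simp
  also have "\<dots> \<le> 4 * n"
  proof (cases "n < 406")
    case False
    then have "(\<mu> n - 2) * (\<mu> n - 3) \<le> 4 * n" by (intro mu_large) auto
    moreover have "(\<mu> n - 3) * (\<mu> n - 4) \<le> (\<mu> n - 2) * (\<mu> n - 3)" by (intro mult_mono) auto
    ultimately show ?thesis by linarith
  qed (rule mu_small)
  finally show False using assms by simp
qed

text \<open>This serves the case k = b = 1, where N - n equals a; the excluded differences are the
  first entries of the exceptional pairs.\<close>

lemma mu_le_mu_add_one:
  assumes "2 * n < N" and "N - n \<notin> {29, 45, 47, 50, 55, 67, 73, 79}"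
  shows "\<mu> n \<le> \<mu> N + 1"
proof (rule ccontr)
  assume contr: "\<not> ?thesis"
  then have N: "2 * N \<le> (\<mu> n - 2) * (\<mu> n - 3)" using lt_mu_imp_le[of N 1 n] by (simp add: numeral_2_eq_2 numeral_3_eq_3)
  with assms(1) have not_le: "\<not> (\<mu> n - 2) * (\<mu> n - 3) \<le> 4 * n" by linarith
  then have n: "n < 406" using mu_large not_less by blast
  with mu_small(2)[OF n] not_le have "n \<in> set exceptional" "(\<mu> n - 2) * (\<mu> n - 3) < 2 * 154" by auto
  with N have "N < 154" by linarith
  from mu_small(4)[OF n \<open>n \<in> set exceptional\<close> this assms(1)] assms(2) contr show False by blast
qed

lemma mu_le_mu_shift:
  assumes "b \<ge> 1" and "n < a"
    and "(a, b) \<notin> {(29, 1), (45, 1), (47, 1), (50, 1), (55, 1), (67, 1), (73, 1), (79, 1)}"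
  shows "\<mu> n \<le> \<mu> (n + k * a) + k * b"
proof (cases "k = 0")
  case False
  then have "a \<le> k * a" by simp
  with assms(2) have lt: "2 * n < n + k * a" by linarith
  show ?thesis
  proof (cases "k * b \<ge> 2")
    case True
    with mu_le_mu_add_two[OF lt] show ?thesis by linarith
  next
    case False
    with \<open>k \<noteq> 0\<close> assms(1) have "k * b = 1"
      by (metis One_nat_def Suc_1 less_Suc_eq less_one mult_is_0 not_less not_one_le_zero)
    then have "k = 1" "b = 1" by auto
    with assms(3) mu_le_mu_add_one[OF lt] show ?thesis by auto
  qed
qed simp

section \<open>The semigroup and its Apery set\<close>

lemma add_submonoid_Inter: "(\<And>M. M \<in> F \<Longrightarrow> add_submonoid M) \<Longrightarrow> add_submonoid (\<Inter>F)"
  unfolding add_submonoid_def by blast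

lemma S_eq: "S a b = {m * a + n * b | m n. \<mu> n \<le> m}" (is "_ = ?R")
proof
  show "S a b \<subseteq> ?R" unfolding S_def
  proof (rule hull_minimal)
    show "{n * a + (n choose 2) * b | n. True} \<subseteq> ?R"
      using generator_in_T by (auto simp flip: T_iff)
    have "x + y \<in> ?R" if "x \<in> ?R" "y \<in> ?R" for x y
    proof -
      from that obtain m n m' n' where "x = m * a + n * b" "(m, n) \<in> T"
        "y = m' * a + n' * b" "(m', n') \<in> T" by (auto simp flip: T_iff)
      then have "x + y = (m + m') * a + (n + n') * b" "\<mu> (n + n') \<le> m + m'"
        using T_add[of m n m' n'] by (simp_all add: algebra_simps T_iff)
      then show ?thesis by blast
    qed
    moreover have "0 \<in> ?R" using mu_zero by force
    ultimately show "add_submonoid ?R" unfolding add_submonoid_def by blast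
  qed
next
  have sub: "add_submonoid (S a b)" unfolding S_def
    by (rule hull_in) (rule add_submonoid_Inter, blast)
  have gen: "i * a + (i choose 2) * b \<in> S a b" for i
    unfolding S_def by (rule hull_inc) blast
  have "m * a + n * b \<in> S a b" if "(m, n) \<in> gen_T" for m n
    using that
  proof induction
    case zero
    then show ?case using sub by (simp add: add_submonoid_def)
  next
    case (step m n i)
    then have "(m * a + n * b) + (i * a + (i choose 2) * b) \<in> S a b"
      using sub gen[of i] by (simp add: add_submonoid_def)
    then show ?case by (simp add: algebra_simps)
  qed
  then show "?R \<subseteq> S a b" by (auto simp flip: T_iff simp: T_eq_gen_T)
qed

theorem corollary7p6:
  fixes a b :: nat
  assumes "a \<ge> 1" and "b \<ge> 1" and "gcd a b = 1"
    and "(a, b) \<notin> {(29, 1), (45, 1), (47, 1), (50, 1), (55, 1), (67, 1), (73, 1), (79, 1)}"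
  shows "Ap (S a b) a = {\<mu> n * a + n * b | n. n \<in> {0..a - 1}}"
proof (intro equalityI subsetI)
  fix s assume "s \<in> Ap (S a b) a"
  then have s: "s \<in> S a b" "int s - int a \<notin> int ` S a b" by (auto simp: Ap_def)
  from s(1) obtain m N where mN: "s = m * a + N * b" "\<mu> N \<le> m" by (auto simp: S_eq)
  \<comment> \<open>Each multiple of a inside N is traded for b further copies of a, which leaves a
    coefficient of b below a.\<close>
  define n k where "n = N mod a" and "k = N div a"
  have N: "N = n + k * a" unfolding n_def k_def by simp
  have n: "n < a" using assms(1) by (simp add: n_def)
  have s_eq: "s = (m + k * b) * a + n * b" by (simp add: mN(1) N algebra_simps)
  have le: "\<mu> n \<le> m + k * b" using mu_le_mu_shift[OF assms(2) n assms(4), of k] mN(2) N by simp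
  have "m + k * b = \<mu> n"
  proof (rule ccontr)
    assume "m + k * b \<noteq> \<mu> n"
    \<comment> \<open>A coefficient above \<mu>(n) could be lowered by one, which would put s - a
      into the semigroup.\<close>
    then obtain j where j: "m + k * b = Suc j" "\<mu> n \<le> j" using le by (cases "m + k * b") auto
    then have "j * a + n * b \<in> S a b" by (auto simp: S_eq)
    moreover have "int s - int a = int (j * a + n * b)" unfolding s_eq j(1) by simp
    ultimately show False using s(2) by blast
  qed
  with s_eq n show "s \<in> {\<mu> n * a + n * b | n. n \<in> {0..a - 1}}" by auto
next
  fix s assume "s \<in> {\<mu> n * a + n * b | n. n \<in> {0..a - 1}}"
  then obtain n where s: "s = \<mu> n * a + n * b" and n: "n < a" using assms(1) by fastforce
  have "int s - int a \<notin> int ` S a b"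
  proof
    assume "int s - int a \<in> int ` S a b"
    then obtain t where t: "t \<in> S a b" "int s - int a = int t" by blast
    then have "s = t + a" by linarith
    with t(1) obtain m N where mN: "s = m * a + N * b + a" "\<mu> N \<le> m" by (auto simp: S_eq)
    \<comment> \<open>Coprimality then cancels b, so N lies in the residue class of n and the
      coefficients of a can be compared.\<close>
    have "[N * b = n * b] (mod a)"
    proof -
      have "(\<mu> n * a + n * b) mod a = (m * a + N * b + a) mod a" using s mN(1) by simp
      then show ?thesis by (simp add: cong_def add.commute)
    qed
    then have "[N = n] (mod a)"
      using assms(3) by (metis cong_mult_rcancel_nat coprime_iff_gcd_eq_1 gcd.commute)
    then have "N mod a = n" using n by (simp add: cong_def)
    then have N: "N = n + (N div a) * a" by (metis add.commute div_mult_mod_eq)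
    define k where "k = N div a"
    have "\<mu> n * a + n * b = (m + k * b + 1) * a + n * b"
      using s mN(1) N unfolding k_def[symmetric] by (simp add: algebra_simps)
    then have "\<mu> n = m + k * b + 1" using assms(1) by (metis add_right_cancel mult_cancel2 not_one_le_zero)
    with mu_le_mu_shift[OF assms(2) n assms(4), of k] mN(2) N k_def show False by simp
  qed
  then show "s \<in> Ap (S a b) a" by (auto simp: Ap_def S_eq s)
qed

end
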